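(* Let $G$ be the group of transformations of maps $s:\{1,\dots,37\}\to\{1,\dots,7\}$ generated by (i) the 12 geometric symmetries of the hexagonal board (rotations by multiples of $60^\circ$ and reflections), acting on cells, and (ii) the $7!$ permutations of the symbols $\{1,\dots,7\}$. Then $G$ maps valid Septoku boards to valid Septoku boards, and the set of valid Septoku boards splits into exactly six $G$-orbits.
   Context: The Septoku board consists of 37 cells forming a regular hexagon of side 4 in a hexagonal grid, numbered row by row: $1$–$4$ (top row), $5$–$9$, $10$–$15$, $16$–$22$, $23$–$28$, $29$–$33$, $34$–$37$ (bottom row). The 21 "rows" of the board (lines of cells in the three grid directions) are: horizontal $\{1,2,3,4\}$, $\{5,\dots,9\}$, $\{10,\dots,15\}$, $\{16,\dots,22\}$, $\{23,\dots,28\}$, $\{29,\dots,33\}$, $\{34,\dots,37\}$; up-right $\{1,5,10,16\}$, $\{2,6,11,17,23\}$, $\{3,7,12,18,24,29\}$, $\{4,8,13,19,25,30,34\}$, $\{9,14,20,26,31,35\}$, $\{15,21,27,32,36\}$, $\{22,28,33,37\}$; down-right $\{4,9,15,22\}$, $\{3,8,14,21,28\}$, $\{2,7,13,20,27,33\}$, $\{1,6,12,19,26,32,37\}$, $\{5,11,18,25,31,36\}$, $\{10,17,24,30,35\}$, $\{16,23,29,34\}$. The seven "circles" (a center cell with its six neighbours) are: $\{1,2,5,6,7,11,12\}$, $\{3,4,7,8,9,13,14\}$, $\{10,11,16,17,18,23,24\}$, $\{12,13,18,19,20,25,26\}$, $\{14,15,20,21,22,27,28\}$, $\{24,25,29,30,31,34,35\}$,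 $\{26,27,31,32,33,36,37\}$. A valid Septoku board is a map $s:\{1,\dots,37\}\to\{1,\dots,7\}$ such that the cells of each of the 21 rows receive pairwise distinct values and the seven cells of each circle receive pairwise distinct values. The 12 geometric symmetries of the hexagonal board permute the cells and preserve the sets of rows and circles; e.g. the $180^\circ$ rotation maps cell $i$ to cell $38-i$. *)

theory Defs
  imports Complex_Main "HOL-Library.FuncSet" "HOL-Library.Disjoint_Sets"
    "HOL-Combinatorics.Permutations"
    "HOL-Algebra.Generated_Groups" "HOL-Algebra.Group_Action"
begin

definition cells :: "nat set" where
  "cells = {1..37}"

definition symbols :: "nat set" where
  "symbols = {1..7}"

definition board_rows :: "nat set set" where
  "board_rows =
    {{1,2,3,4}, {5,6,7,8,9}, {10,11,12,13,14,15}, {16,17,18,19,20,21,22},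
     {23,24,25,26,27,28}, {29,30,31,32,33}, {34,35,36,37},
     {1,5,10,16}, {2,6,11,17,23}, {3,7,12,18,24,29}, {4,8,13,19,25,30,34},
     {9,14,20,26,31,35}, {15,21,27,32,36}, {22,28,33,37},
     {4,9,15,22}, {3,8,14,21,28}, {2,7,13,20,27,33}, {1,6,12,19,26,32,37},
     {5,11,18,25,31,36}, {10,17,24,30,35}, {16,23,29,34}}"

definition circles :: "nat set set" where
  "circles =
    {{1,2,5,6,7,11,12}, {3,4,7,8,9,13,14}, {10,11,16,17,18,23,24},
     {12,13,18,19,20,25,26}, {14,15,20,21,22,27,28},
     {24,25,29,30,31,34,35}, {26,27,31,32,33,36,37}}"

text \<open>All maps from cells to symbols; functions are fixed to be \<open>undefined\<close> outside \<open>cells\<close>,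
  so that equality of boards is equality on the 37 cells.\<close>

definition boards :: "(nat \<Rightarrow> nat) set" where
  "boards = cells \<rightarrow>\<^sub>E symbols"

definition valid_boards :: "(nat \<Rightarrow> nat) set" where
  "valid_boards =
    {s \<in> boards. (\<forall>L \<in> board_rows. inj_on s L) \<and> (\<forall>C \<in> circles. inj_on s C)}"

text \<open>Centres of the 37 hexagons in the complex plane, in the order of the numbering, with
  adjacent cells at distance 1 and cell 19 at the origin. A pair \<open>(n, h)\<close> describes a horizontal
  line of \<open>n\<close> cells at height \<open>h * sqrt 3 / 2\<close>.\<close>

definition centres :: "complex list" where
  "centres = concat (map (\<lambda>(n, h). map (\<lambda>j. Complex (real j - (real n - 1) / 2) (h * sqrt 3 / 2)) [0..<n])
    [(4, 3), (5, 2), (6, 1), (7, 0), (6, - 1), (5, - 2), (4, - 3)])"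

definition centre :: "nat \<Rightarrow> complex" where
  "centre i = centres ! (i - 1)"

definition hexagon_isometries :: "(complex \<Rightarrow> complex) set" where
  "hexagon_isometries =
    {(\<lambda>z. cis (real k * pi / 3) * z) | k. k < (6::nat)} \<union>
    {(\<lambda>z. cis (real k * pi / 3) * cnj z) | k. k < (6::nat)}"

definition geometric_symmetries :: "(nat \<Rightarrow> nat) set" where
  "geometric_symmetries =
    {p. p permutes cells \<and>
        (\<exists>f \<in> hexagon_isometries. \<forall>i \<in> cells. centre (p i) = f (centre i))}"

text \<open>The symbol in cell \<open>i\<close> is moved to cell \<open>p i\<close>.\<close>

definition move_cells :: "(nat \<Rightarrow> nat) \<Rightarrow> (nat \<Rightarrow> nat) \<Rightarrow> (nat \<Rightarrow> nat)" where
  "move_cells p = (\<lambda>s \<in> boards. \<lambda>i \<in> cells. s (inv_into cells p i))"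

definition relabel :: "(nat \<Rightarrow> nat) \<Rightarrow> (nat \<Rightarrow> nat) \<Rightarrow> (nat \<Rightarrow> nat)" where
  "relabel q = (\<lambda>s \<in> boards. \<lambda>i \<in> cells. q (s i))"

definition septoku_group :: "((nat \<Rightarrow> nat) \<Rightarrow> (nat \<Rightarrow> nat)) monoid" where
  "septoku_group = (BijGroup boards)
    \<lparr>carrier := generate (BijGroup boards)
      (move_cells ` geometric_symmetries \<union> relabel ` {q. q permutes symbols})\<rparr>"

text \<open>The group consists of transformations of \<open>boards\<close>, so its action is application.\<close>

definition septoku_orbits :: "(nat \<Rightarrow> nat) set set" where
  "septoku_orbits = orbits septoku_group valid_boards (\<lambda>g. g)"

end

theory Submission
  imports Defs
begin

text \<open>After relabelling, the middle row 16 to 22 of a valid board reads 1 to 7, and an exhaustive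
  search over the remaining 30 cells leaves 24 boards. Geometric symmetries and relabellings commute,
  so two boards lie in the same orbit iff one is obtained from the other by one of the 12 symmetries
  followed by a relabelling. For a given symmetry the relabelling is dictated by the middle row, so
  comparing boards up to equivalence amounts to 12 equality tests of lists. These tests show
  that six of the 24 boards are pairwise inequivalent and that every other one is equivalent
  to one of them. The symmetries are computed in coordinates of the triangular lattice spanned
  by 1 and \<open>cis (pi / 3)\<close>.\<close>

section \<open>Executable search and executable symmetries\<close>

text \<open>Rows and circles impose the same condition, injectivity, so they are merged; lists make
  the incidence relation computable.\<close>

definition lines :: "nat list list" where
  "lines =
    [[1,2,3,4], [5,6,7,8,9], [10,11,12,13,14,15], [16,17,18,19,20,21,22],
     [23,24,25,26,27,28], [29,30,31,32,33], [34,35,36,37],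
     [1,5,10,16], [2,6,11,17,23], [3,7,12,18,24,29], [4,8,13,19,25,30,34],
     [9,14,20,26,31,35], [15,21,27,32,36], [22,28,33,37],
     [4,9,15,22], [3,8,14,21,28], [2,7,13,20,27,33], [1,6,12,19,26,32,37],
     [5,11,18,25,31,36], [10,17,24,30,35], [16,23,29,34],
     [1,2,5,6,7,11,12], [3,4,7,8,9,13,14], [10,11,16,17,18,23,24],
     [12,13,18,19,20,25,26], [14,15,20,21,22,27,28],
     [24,25,29,30,31,34,35], [26,27,31,32,33,36,37]]"

definition on_line :: "nat \<Rightarrow> nat \<Rightarrow> bool" where
  "on_line i j \<longleftrightarrow> list_ex (\<lambda>l. List.member l i \<and> List.member l j) lines"

text \<open>The flags mark the already filled cells that share a line with the cell to be filled.\<close>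

fun available :: "bool list \<Rightarrow> nat list \<Rightarrow> nat list" where
  "available (True # bs) (v # vs) = removeAll v (available bs vs)"
| "available (False # bs) (v # vs) = available bs vs"
| "available _ _ = [1,2,3,4,5,6,7]"

definition extensions :: "bool list \<Rightarrow> nat list list \<Rightarrow> nat list list" where
  "extensions bs xss = concat (map (\<lambda>xs. map (\<lambda>v. v # xs) (available bs xs)) xss)"

text \<open>Breadth first: \<open>ds\<close> holds the filled cells, latest first, and each partial
  board in \<open>xss\<close> lists their symbols in the same order. The flags therefore depend on
  \<open>c\<close> and \<open>ds\<close> alone and serve all partial boards.\<close>

primrec search :: "nat list \<Rightarrow> nat list \<Rightarrow> nat list list \<Rightarrow> nat list list" where
  "search [] ds xss = xss"
| "search (c # cs) ds xss = search cs (c # ds) (extensions (map (on_line c) ds) xss)"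

text \<open>This order was found by local search; it keeps the number of visited partial boards
  below 6000.\<close>

definition filling_order :: "nat list" where
  "filling_order =
    [14,27,15,28,26,13,12,25,11,24,10,23,7,29,3,2,33,31,36,5,1,6,9,35,8,4,32,30,34,37]"

text \<open>Descending, following the convention that the latest filled cell comes first. Paired
  with \<open>[7,6,5,4,3,2,1]\<close>, it puts symbol \<open>v\<close> into cell
  \<open>v + 15\<close>.\<close>

definition middle_row :: "nat list" where
  "middle_row = [22,21,20,19,18,17,16]"

definition cell_list :: "nat list" where
  "cell_list = [1..<38]"

definition by_cell :: "nat list \<Rightarrow> nat list \<Rightarrow> nat list" where
  "by_cell cs xs = map (\<lambda>i. the (map_of (zip cs xs) i)) cell_list"

text \<open>Cells count from 1, list positions from 0. The same operation composes a board with a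
  cell permutation, reads off the symbols along a line, and maps a line through a permutation
  table.\<close>

definition permute_list_by :: "nat list \<Rightarrow> nat list \<Rightarrow> nat list" where
  "permute_list_by P xs = map (\<lambda>i. xs ! (i - 1)) P"

text \<open>Position \<open>i - 1\<close> holds the image of cell \<open>i\<close> under the
  counterclockwise rotation by 60 degrees.\<close>

definition rotation_table :: "nat list" where
  "rotation_table =
    [16,10,5,1,23,17,11,6,2,29,24,18,12,7,3,34,30,25,19,
     13,8,4,35,31,26,20,14,9,36,32,27,21,15,37,33,28,22]"

text \<open>Complex conjugation, that is, the reflection in the axis through the middle row.\<close>

definition reflection_table :: "nat list" where
  "reflection_table =
    [34,35,36,37,29,30,31,32,33,23,24,25,26,27,28,16,17,18,19,
     20,21,22,10,11,12,13,14,15,5,6,7,8,9,1,2,3,4]"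

primrec rotations :: "nat \<Rightarrow> nat list \<Rightarrow> nat list list" where
  "rotations 0 xs = []"
| "rotations (Suc n) xs = xs # rotations n (permute_list_by rotation_table xs)"

definition images :: "nat list \<Rightarrow> nat list list" where
  "images xs = rotations 6 xs @ map (permute_list_by reflection_table) (rotations 6 xs)"

text \<open>The symbols of the middle row occupy the list positions 15 to 21. If that row of \<open>xs\<close> reads
  1 to 7, then the middle row of \<open>ys\<close> lists the only relabelling that can turn \<open>xs\<close>
  into \<open>ys\<close>.\<close>

definition matches :: "nat list \<Rightarrow> nat list \<Rightarrow> bool" where
  "matches xs ys \<longleftrightarrow> map (\<lambda>v. ys ! (v + 14)) xs = ys"

definition representatives :: "nat list list" where
  "representatives =
    [[3,1,5,6,5,7,4,3,2,4,6,2,7,1,3,1,2,3,4,5,6,7,5,7,1,6,2,4,6,5,4,1,3,2,3,7,5],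
     [3,4,5,6,7,1,2,3,4,4,5,6,7,1,2,1,2,3,4,5,6,7,6,7,1,2,3,4,4,5,6,7,1,2,3,4,5],
     [3,1,2,6,2,7,4,5,3,4,5,6,7,1,2,1,2,3,4,5,6,7,6,7,1,2,3,4,5,3,4,1,6,2,6,7,5],
     [3,1,4,2,4,7,6,5,3,6,5,2,7,1,4,1,2,3,4,5,6,7,4,7,1,6,3,2,5,3,2,1,4,6,4,7,5],
     [2,4,5,3,6,3,1,7,4,4,5,7,6,2,1,1,2,3,4,5,6,7,7,6,2,1,3,4,4,1,7,5,2,5,3,4,6],
     [2,7,5,3,6,3,4,7,1,7,5,1,6,2,4,1,2,3,4,5,6,7,4,6,2,7,3,1,7,1,4,5,2,5,3,1,6]]"

section \<open>Facts about the representatives established by evaluation\<close>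

text \<open>The whole exhaustive search runs here. It yields the upper bound of six orbits.\<close>

lemma representatives_complete:
  "list_all (\<lambda>xs. list_ex (\<lambda>r. list_ex (matches r) (images xs)) representatives)
    (map (by_cell (rev filling_order @ middle_row))
      (search filling_order middle_row [[7,6,5,4,3,2,1]]))"
  by code_simp

text \<open>This yields the lower bound. The diagonal is exempt because the identity always matches
  a list with itself.\<close>

lemma representatives_inequivalent:
  "list_all (\<lambda>i. list_all (\<lambda>j. i = j \<or>
      \<not> list_ex (matches (representatives ! i)) (images (representatives ! j))) [0..<6]) [0..<6]"
  by code_simp

text \<open>The search is only shown to miss no valid board, so the validity of the six lists is
  checked directly.\<close>

lemma representatives_valid:
  "list_all (\<lambda>r. list_all (\<lambda>l. distinct (permute_list_by l r)) lines) representatives"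
  by code_simp

lemma set_lines: "set ` set lines = board_rows \<union> circles"
  by (simp only: lines_def board_rows_def circles_def list.set image_insert image_empty
      Un_insert_left Un_empty_left)

lemma valid_boards_iff:
  "s \<in> valid_boards \<longleftrightarrow> s \<in> boards \<and> (\<forall>l\<in>set lines. inj_on s (set l))"
proof -
  have "(\<forall>l\<in>set lines. inj_on s (set l)) \<longleftrightarrow> (\<forall>L\<in>set ` set lines. inj_on s L)"
    by blast
  then show ?thesis
    unfolding set_lines by (auto simp: valid_boards_def)
qed

lemma lines_subset_cells: "l \<in> set lines \<Longrightarrow> set l \<subseteq> cells"
  by (auto simp: lines_def cells_def)

lemma on_line_iff: "on_line i j \<longleftrightarrow> (\<exists>l\<in>set lines. i \<in> set l \<and> j \<in> set l)"
  by (simp add: on_line_def list_ex_iff)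

lemma board_symbol: "s \<in> boards \<Longrightarrow> i \<in> cells \<Longrightarrow> s i \<in> symbols"
  by (auto simp: boards_def)

lemma board_eqI: "s \<in> boards \<Longrightarrow> t \<in> boards \<Longrightarrow> (\<And>i. i \<in> cells \<Longrightarrow> s i = t i) \<Longrightarrow> s = t"
  unfolding boards_def by (rule PiE_ext)

lemma symbols_list: "symbols = set [1,2,3,4,5,6,7]"
  by (auto simp: symbols_def)

lemma set_cell_list [simp]: "set cell_list = cells"
  by (auto simp: cell_list_def cells_def)

lemma length_cell_list [simp]: "length cell_list = 37"
  by (simp add: cell_list_def)

lemma distinct_cell_list [simp]: "distinct cell_list"
  by (simp add: cell_list_def)

lemma nth_cell_list: "n < 37 \<Longrightarrow> cell_list ! n = Suc n"
  by (simp add: cell_list_def del: upt_rec_numeral)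

lemma nth_map_cell_list: "i \<in> cells \<Longrightarrow> map f cell_list ! (i - 1) = f i"
  by (subst nth_map) (auto simp: cells_def nth_cell_list)

subsection \<open>Exhaustive search\<close>

text \<open>A symbol is discarded only if a filled cell on a common line carries it.\<close>

lemma mem_available:
  assumes "v \<in> symbols" and "\<And>d. d \<in> set ds \<Longrightarrow> on_line c d \<Longrightarrow> s d \<noteq> v"
  shows "v \<in> set (available (map (on_line c) ds) (map s ds))"
  using assms(2)
proof (induction ds)
  case Nil
  then show ?case using assms(1) by (simp add: symbols_list)
next
  case (Cons d ds)
  then show ?case by (cases "on_line c d") auto
qed

text \<open>Invariant: the restriction of \<open>s\<close> to the filled cells is among the partial
  boards. Pruning keeps it, since \<open>s\<close> takes distinct values at two cells of a common
  line.\<close>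

lemma search_complete:
  assumes "s \<in> valid_boards" "set cs \<subseteq> cells" "distinct (cs @ ds)" "map s ds \<in> set xss"
  shows "map s (rev cs @ ds) \<in> set (search cs ds xss)"
  using assms(2-)
proof (induction cs arbitrary: ds xss)
  case Nil
  then show ?case by simp
next
  case (Cons c cs)
  have "s d \<noteq> s c" if d: "d \<in> set ds" and "on_line c d" for d
  proof -
    obtain l where "l \<in> set lines" "c \<in> set l" "d \<in> set l"
      using \<open>on_line c d\<close> by (auto simp: on_line_iff)
    \<comment> \<open>\<open>on_line\<close> also relates a cell to itself, so distinctness of the
      two cells must come from the filling order.\<close>
    moreover have "c \<noteq> d"
      using Cons.prems(2) d by auto
    ultimately show ?thesis
      using assms(1) by (metis inj_onD valid_boards_iff)
  qed
  moreover have "s c \<in> symbols"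
    using Cons.prems(1) assms(1) by (auto simp: valid_boards_iff intro: board_symbol)
  ultimately have "s c \<in> set (available (map (on_line c) ds) (map s ds))"
    by (rule mem_available[rotated])
  then have "map s (c # ds) \<in> set (extensions (map (on_line c) ds) xss)"
    using Cons.prems(3) by (force simp: extensions_def)
  from Cons.IH[OF _ _ this] show ?case
    using Cons.prems(1,2) by auto
qed

lemma by_cell_map:
  assumes "set cs = cells"
  shows "by_cell cs (map s cs) = map s cell_list"
  using assms by (auto simp: by_cell_def map_of_zip_map)

text \<open>A single evaluated sort certifies that a list enumerates every cell exactly once; this
  serves the filling order and both tables.\<close>

lemma sort_eq_cells:
  assumes "sort xs = cell_list"
  shows "set xs = cells" "distinct xs" "length xs = 37"
  using arg_cong[OF assms, of set] arg_cong[OF assms, of distinct] arg_cong[OF assms, of length]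
  by simp_all

lemma sort_filling_order: "sort (rev filling_order @ middle_row) = cell_list"
  by code_simp

subsection \<open>Cells as points of the triangular lattice\<close>

definition omega :: complex where
  "omega = cis (pi / 3)"

lemma omega_eq: "omega = Complex (1 / 2) (sqrt 3 / 2)"
  by (simp add: omega_def complex_eq_iff cos_60 sin_60)

lemma omega_power6: "omega ^ 6 = 1"
  unfolding omega_def DeMoivre by simp

lemma omega_power_mod: "omega ^ (k mod 6) = omega ^ k"
proof -
  have "omega ^ k = omega ^ (6 * (k div 6) + k mod 6)"
    by simp
  also have "\<dots> = omega ^ (k mod 6)"
    by (simp only: power_add power_mult omega_power6) simp
  finally show ?thesis ..
qed

text \<open>Integer pairs turn the comparison of centres into integer arithmetic, free of
  \<open>sqrt 3\<close>.\<close>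

definition lattice_point :: "int \<times> int \<Rightarrow> complex" where
  "lattice_point = (\<lambda>(x, y). of_int x + of_int y * omega)"

text \<open>In the order of the cells: all pairs in which \<open>x\<close>, \<open>y\<close> and
  \<open>x + y\<close> lie between -3 and 3.\<close>

definition coordinates :: "(int \<times> int) list" where
  "coordinates =
    [(-3,3),(-2,3),(-1,3),(0,3),(-3,2),(-2,2),(-1,2),(0,2),(1,2),
     (-3,1),(-2,1),(-1,1),(0,1),(1,1),(2,1),(-3,0),(-2,0),(-1,0),(0,0),(1,0),(2,0),(3,0),
     (-2,-1),(-1,-1),(0,-1),(1,-1),(2,-1),(3,-1),(-1,-2),(0,-2),(1,-2),(2,-2),(3,-2),
     (0,-3),(1,-3),(2,-3),(3,-3)]"

lemma centres_eq: "centres = map lattice_point coordinates"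
  by (simp add: centres_def coordinates_def lattice_point_def omega_eq complex_eq_iff upt_rec)

lemma length_coordinates: "length coordinates = 37"
  by (simp add: coordinates_def)

lemma inj_lattice_point: "inj lattice_point"
  by (auto simp: inj_def lattice_point_def omega_eq complex_eq_iff)

lemma distinct_coordinates: "distinct coordinates"
  by (simp add: coordinates_def)

lemma centre_eq: "i \<in> cells \<Longrightarrow> centre i = lattice_point (coordinates ! (i - 1))"
  by (auto simp: centre_def centres_eq cells_def length_coordinates intro!: nth_map)

lemma inj_on_centre: "inj_on centre cells"
proof (rule inj_onI)
  fix i j assume ij: "i \<in> cells" "j \<in> cells" "centre i = centre j"
  then have "coordinates ! (i - 1) = coordinates ! (j - 1)"
    by (simp add: centre_eq inj_eq inj_lattice_point)
  then have "i - 1 = j - 1"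
    using ij by (subst (asm) nth_eq_iff_index_eq) (auto simp: distinct_coordinates length_coordinates cells_def)
  then show "i = j"
    using ij by (auto simp: cells_def)
qed

text \<open>The identity outside \<open>cells\<close> is what \<open>permutes\<close>
  demands.\<close>

definition apply_table :: "nat list \<Rightarrow> nat \<Rightarrow> nat" where
  "apply_table P i = (if i \<in> cells then P ! (i - 1) else i)"

text \<open>A map of a finite set onto itself is injective, so it is enough to read surjectivity off
  the table.\<close>

lemma apply_table_permutes:
  assumes "sort P = cell_list"
  shows "apply_table P permutes cells"
proof (rule bij_imp_permutes)
  have "apply_table P ` cells = set P"
  proof -
    have "cells = Suc ` {..<37}"
      by (simp add: cells_def image_Suc_lessThan)
    then have "apply_table P ` cells = (\<lambda>i. apply_table P (Suc i)) ` {..<37}"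
      by (metis image_image)
    also have "\<dots> = (\<lambda>i. P ! i) ` {..<37}"
      by (intro image_cong) (auto simp: apply_table_def cells_def)
    finally have "apply_table P ` cells = (\<lambda>i. P ! i) ` {..<37}" .
    then show ?thesis
      using sort_eq_cells(3)[OF assms]
      by (auto simp: set_conv_nth)
  qed
  then show "bij_betw (apply_table P) cells cells"
    using sort_eq_cells(1)[OF assms] by (simp add: bij_betw_def eq_card_imp_inj_on cells_def)
qed (simp add: apply_table_def)

lemma sort_rotation_table: "sort rotation_table = cell_list"
  by code_simp

lemma sort_reflection_table: "sort reflection_table = cell_list"
  by code_simp

abbreviation "rotate_cell \<equiv> apply_table rotation_table"
abbreviation "reflect_cell \<equiv> apply_table reflection_table"

lemma rotate_permutes: "rotate_cell permutes cells"
  and reflect_permutes: "reflect_cell permutes cells"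
  by (simp_all add: apply_table_permutes sort_rotation_table sort_reflection_table)

text \<open>Here \<open>g\<close> is a plane map in lattice coordinates; one equation between lists
  settles all 37 cells.\<close>

lemma apply_table_centre:
  assumes "map (\<lambda>i. coordinates ! (i - 1)) P = map g coordinates" "set P = cells" "i \<in> cells"
  shows "centre (apply_table P i) = lattice_point (g (coordinates ! (i - 1)))"
proof -
  have i: "i - 1 < 37"
    using assms(3) by (auto simp: cells_def)
  have "length P = 37"
    using arg_cong[OF assms(1), of length] by (simp add: length_coordinates)
  have "coordinates ! (P ! (i - 1) - 1) = g (coordinates ! (i - 1))"
    using arg_cong[OF assms(1), of "\<lambda>xs. xs ! (i - 1)"] i \<open>length P = 37\<close>
    by (simp add: length_coordinates)
  moreover have "P ! (i - 1) \<in> cells"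
    using i \<open>length P = 37\<close> assms(2) by (metis nth_mem)
  ultimately show ?thesis
    using assms(3) by (simp add: apply_table_def centre_eq)
qed

lemma centre_rotate:
  assumes "i \<in> cells"
  shows "centre (rotate_cell i) = omega * centre i"
proof -
  \<comment> \<open>Since \<open>omega ^ 2 = omega - 1\<close>, multiplying
    \<open>x + y * omega\<close> by \<open>omega\<close> gives
    \<open>- y + (x + y) * omega\<close>.\<close>
  have "map (\<lambda>i. coordinates ! (i - 1)) rotation_table = map (\<lambda>(x, y). (- y, x + y)) coordinates"
    by (simp add: rotation_table_def coordinates_def)
  from apply_table_centre[OF this sort_eq_cells(1)[OF sort_rotation_table] assms] show ?thesis
    using assms by (simp add: centre_eq lattice_point_def case_prod_unfold omega_eq complex_eq_iff field_simps)
qed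

lemma centre_reflect:
  assumes "i \<in> cells"
  shows "centre (reflect_cell i) = cnj (centre i)"
proof -
  \<comment> \<open>Since \<open>cnj omega = 1 - omega\<close>, conjugation sends
    \<open>x + y * omega\<close> to \<open>(x + y) - y * omega\<close>.\<close>
  have "map (\<lambda>i. coordinates ! (i - 1)) reflection_table = map (\<lambda>(x, y). (x + y, - y)) coordinates"
    by (simp add: reflection_table_def coordinates_def)
  from apply_table_centre[OF this sort_eq_cells(1)[OF sort_reflection_table] assms] show ?thesis
    using assms by (simp add: centre_eq lattice_point_def case_prod_unfold omega_eq complex_eq_iff field_simps)
qed

subsection \<open>The group of geometric symmetries\<close>

text \<open>Without the bound on the exponent, products of powers need no reduction modulo
  6.\<close>

lemma hexagon_isometries_eq:
  "hexagon_isometries = range (\<lambda>k z. omega ^ k * z) \<union> range (\<lambda>k z. omega ^ k * cnj z)"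
proof -
  have c: "cis (real k * pi / 3) = omega ^ k" for k
    unfolding omega_def DeMoivre by simp
  have *: "{F (omega ^ k) | k. k < 6} = range (\<lambda>k. F (omega ^ k))"
    for F :: "complex \<Rightarrow> complex \<Rightarrow> complex"
  proof
    show "range (\<lambda>k. F (omega ^ k)) \<subseteq> {F (omega ^ k) | k. k < 6}"
    proof clarify
      fix k :: nat
      have "omega ^ k = omega ^ (k mod 6)" "k mod 6 < 6"
        by (simp_all add: omega_power_mod)
      then show "\<exists>m. F (omega ^ k) = F (omega ^ m) \<and> m < 6"
        by metis
    qed
  qed auto
  show ?thesis
    unfolding hexagon_isometries_def c *[of "\<lambda>w z. w * z"] *[of "\<lambda>w z. w * cnj z"] ..
qed

text \<open>\<open>cnj omega\<close> is the inverse of \<open>omega\<close>, hence its fifth power.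
  This moves a conjugation past a rotation.\<close>

lemma cnj_omega_power: "\<exists>m. cnj (omega ^ k) = omega ^ m"
proof -
  have "cnj omega = omega ^ 5"
  proof -
    have "omega * cnj omega = 1"
      by (simp add: omega_eq complex_eq_iff)
    then have "omega ^ 5 * (omega * cnj omega) = omega ^ 5"
      by simp
    moreover have "omega ^ 5 * (omega * cnj omega) = omega ^ 6 * cnj omega"
      by (simp add: eval_nat_numeral)
    ultimately show ?thesis
      by (simp add: omega_power6)
  qed
  then show ?thesis
    by (metis complex_cnj_power power_mult)
qed

lemma hexagon_isometries_comp:
  assumes "f \<in> hexagon_isometries" "g \<in> hexagon_isometries"
  shows "f \<circ> g \<in> hexagon_isometries"
proof -
  obtain a where f: "f = (\<lambda>z. omega ^ a * z) \<or> f = (\<lambda>z. omega ^ a * cnj z)"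
    using assms(1) by (auto simp: hexagon_isometries_eq)
  obtain b where g: "g = (\<lambda>z. omega ^ b * z) \<or> g = (\<lambda>z. omega ^ b * cnj z)"
    using assms(2) by (auto simp: hexagon_isometries_eq)
  obtain m where m: "cnj (omega ^ b) = omega ^ m"
    using cnj_omega_power by blast
  \<comment> \<open>A conjugation in \<open>f\<close> turns the factor \<open>omega ^ b\<close> of
    \<open>g\<close> into \<open>omega ^ m\<close>; otherwise the exponents simply add.\<close>
  have "f \<circ> g \<in> {(\<lambda>z. omega ^ (a + b) * z), (\<lambda>z. omega ^ (a + b) * cnj z),
     (\<lambda>z. omega ^ (a + m) * z), (\<lambda>z. omega ^ (a + m) * cnj z)}"
    using f g m by (auto simp: fun_eq_iff power_add mult.assoc simp del: complex_cnj_power)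
  then show ?thesis
    unfolding hexagon_isometries_eq by blast
qed

lemma hexagon_isometries_inverse:
  assumes "f \<in> hexagon_isometries"
  shows "\<exists>g\<in>hexagon_isometries. \<forall>z. g (f z) = z"
proof -
  obtain a where f: "f = (\<lambda>z. omega ^ a * z) \<or> f = (\<lambda>z. omega ^ a * cnj z)"
    using assms by (auto simp: hexagon_isometries_eq)
  \<comment> \<open>The exponent \<open>5 * a\<close> stands for \<open>- a\<close>, because
    \<open>omega ^ 6 = 1\<close>.\<close>
  have inv: "omega ^ (5 * a) * omega ^ a = 1"
  proof -
    have "omega ^ (5 * a) * omega ^ a = (omega ^ 6) ^ a"
      by (simp flip: power_add power_mult)
    then show ?thesis by (simp add: omega_power6)
  qed
  obtain m where m: "cnj (omega ^ (5 * a)) = omega ^ m"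
    using cnj_omega_power by blast
  have mem: "(\<lambda>z. omega ^ k * z) \<in> hexagon_isometries" "(\<lambda>z. omega ^ k * cnj z) \<in> hexagon_isometries" for k
    unfolding hexagon_isometries_eq by auto
  from f show ?thesis
  proof
    assume "f = (\<lambda>z. omega ^ a * z)"
    then have "\<forall>z. omega ^ (5 * a) * f z = z"
      by (simp add: inv flip: mult.assoc)
    then show ?thesis
      using mem(1)[of "5 * a"] by (rule bexI)
  next
    assume "f = (\<lambda>z. omega ^ a * cnj z)"
    then have "\<forall>z. omega ^ m * cnj (f z) = z"
      using arg_cong[OF inv, of cnj] unfolding m[symmetric] by (simp flip: mult.assoc)
    then show ?thesis
      using mem(2)[of m] by (rule bexI)
  qed
qed

lemma geometric_permutes: "p \<in> geometric_symmetries \<Longrightarrow> p permutes cells"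
  by (simp add: geometric_symmetries_def)

lemma geometric_symmetriesI:
  assumes "p permutes cells" "f \<in> hexagon_isometries" "\<And>i. i \<in> cells \<Longrightarrow> centre (p i) = f (centre i)"
  shows "p \<in> geometric_symmetries"
  using assms unfolding geometric_symmetries_def by blast

lemma geometric_comp:
  assumes "p \<in> geometric_symmetries" "q \<in> geometric_symmetries"
  shows "p \<circ> q \<in> geometric_symmetries"
proof -
  obtain f where p: "p permutes cells" "f \<in> hexagon_isometries" "\<And>i. i \<in> cells \<Longrightarrow> centre (p i) = f (centre i)"
    using assms(1) by (auto simp: geometric_symmetries_def)
  obtain g where q: "q permutes cells" "g \<in> hexagon_isometries" "\<And>i. i \<in> cells \<Longrightarrow> centre (q i) = g (centre i)"
    using assms(2) by (auto simp: geometric_symmetries_def)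
  have "centre ((p \<circ> q) i) = (f \<circ> g) (centre i)" if "i \<in> cells" for i
    using that p(3) q(3) permutes_in_image[OF q(1)] by simp
  then show ?thesis
    by (rule geometric_symmetriesI[OF permutes_compose[OF q(1) p(1)] hexagon_isometries_comp[OF p(2) q(2)]])
qed

lemma geometric_inv:
  assumes "p \<in> geometric_symmetries"
  shows "Hilbert_Choice.inv p \<in> geometric_symmetries"
proof -
  obtain f where p: "p permutes cells" "f \<in> hexagon_isometries" "\<And>i. i \<in> cells \<Longrightarrow> centre (p i) = f (centre i)"
    using assms by (auto simp: geometric_symmetries_def)
  obtain g where g: "g \<in> hexagon_isometries" "\<And>z. g (f z) = z"
    using hexagon_isometries_inverse[OF p(2)] by blast
  have "centre (Hilbert_Choice.inv p i) = g (centre i)" if "i \<in> cells" for i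
  proof -
    have "Hilbert_Choice.inv p i \<in> cells"
      using that permutes_in_image[OF permutes_inv[OF p(1)]] by simp
    from p(3)[OF this] have "centre i = f (centre (Hilbert_Choice.inv p i))"
      by (simp add: permutes_inverses[OF p(1)])
    then show ?thesis
      by (simp add: g(2))
  qed
  then show ?thesis
    by (rule geometric_symmetriesI[OF permutes_inv[OF p(1)] g(1)])
qed

lemma id_geometric: "id \<in> geometric_symmetries"
proof (rule geometric_symmetriesI[OF permutes_id])
  show "(\<lambda>z. omega ^ 0 * z) \<in> hexagon_isometries"
    unfolding hexagon_isometries_eq by blast
qed simp

lemma rotate_geometric: "rotate_cell \<in> geometric_symmetries"
proof (rule geometric_symmetriesI[OF rotate_permutes])
  show "(\<lambda>z. omega ^ 1 * z) \<in> hexagon_isometries"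
    unfolding hexagon_isometries_eq by blast
qed (simp add: centre_rotate)

lemma reflect_geometric: "reflect_cell \<in> geometric_symmetries"
proof (rule geometric_symmetriesI[OF reflect_permutes])
  show "(\<lambda>z. omega ^ 0 * cnj z) \<in> hexagon_isometries"
    unfolding hexagon_isometries_eq by blast
qed (simp add: centre_reflect)

lemma rotations_geometric: "rotate_cell ^^ k \<in> geometric_symmetries"
proof (induction k)
  case 0
  show ?case
    unfolding funpow.simps by (rule id_geometric)
next
  case (Suc k)
  show ?case
    unfolding funpow.simps by (rule geometric_comp[OF rotate_geometric Suc.IH])
qed

lemma centre_rotations: "i \<in> cells \<Longrightarrow> centre ((rotate_cell ^^ k) i) = omega ^ k * centre i"
proof (induction k)
  case (Suc k)
  have "(rotate_cell ^^ k) i \<in> cells"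
    using permutes_in_image[OF geometric_permutes[OF rotations_geometric]] Suc.prems by simp
  from centre_rotate[OF this] Suc.IH[OF Suc.prems] show ?case by simp
qed simp

text \<open>Distinct cells have distinct centres, and both permutations fix everything outside
  \<open>cells\<close>.\<close>

lemma geometric_eqI:
  assumes "p permutes cells" "q permutes cells" "\<And>i. i \<in> cells \<Longrightarrow> centre (p i) = centre (q i)"
  shows "p = q"
proof
  fix i
  show "p i = q i"
  proof (cases "i \<in> cells")
    case True
    then show ?thesis
      using assms inj_on_centre by (metis inj_onD permutes_in_image)
  next
    case False
    then show ?thesis
      using assms by (simp add: permutes_not_in)
  qed
qed

text \<open>A symmetry is determined by its isometry, and each isometry is realised by a power of
  the rotation, preceded by the reflection if it conjugates. Quantifying over symmetries thus
  becomes a finite enumeration.\<close>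

lemma geometric_symmetries_eq:
  "geometric_symmetries = (\<lambda>k. rotate_cell ^^ k) ` {..<6} \<union> (\<lambda>k. rotate_cell ^^ k \<circ> reflect_cell) ` {..<6}"
    (is "?G = ?R \<union> ?S")
proof
  show "?R \<union> ?S \<subseteq> ?G"
    by (auto intro: geometric_comp rotations_geometric reflect_geometric)
  show "?G \<subseteq> ?R \<union> ?S"
  proof
    fix p assume p: "p \<in> ?G"
    then obtain f where f: "f \<in> hexagon_isometries" "\<And>i. i \<in> cells \<Longrightarrow> centre (p i) = f (centre i)"
      by (auto simp: geometric_symmetries_def)
    from f(1) obtain k where k: "f = (\<lambda>z. omega ^ k * z) \<or> f = (\<lambda>z. omega ^ k * cnj z)"
      by (auto simp: hexagon_isometries_eq)
    from k have "p = rotate_cell ^^ (k mod 6) \<or> p = rotate_cell ^^ (k mod 6) \<circ> reflect_cell"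
    proof
      assume "f = (\<lambda>z. omega ^ k * z)"
      then have "p = rotate_cell ^^ (k mod 6)"
        using f(2) by (intro geometric_eqI geometric_permutes p rotations_geometric)
          (simp add: centre_rotations omega_power_mod)
      then show ?thesis ..
    next
      assume "f = (\<lambda>z. omega ^ k * cnj z)"
      then have "p = rotate_cell ^^ (k mod 6) \<circ> reflect_cell"
        using f(2) reflect_permutes
        by (intro geometric_eqI geometric_permutes p geometric_comp rotations_geometric reflect_geometric)
          (simp add: centre_rotations omega_power_mod centre_reflect permutes_in_image)
      then show ?thesis ..
    qed
    then show "p \<in> ?R \<union> ?S"
      by auto
  qed
qed

section \<open>Symmetries act on rows and circles\<close>

text \<open>Inclusion in some line is enough, since injectivity passes to subsets.\<close>

definition preserves_lines :: "(nat \<Rightarrow> nat) \<Rightarrow> bool" where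
  "preserves_lines p \<longleftrightarrow> (\<forall>l\<in>set lines. \<exists>m\<in>set lines. p ` set l \<subseteq> set m)"

lemma preserves_lines_comp:
  assumes "preserves_lines p" "preserves_lines q"
  shows "preserves_lines (p \<circ> q)"
  unfolding preserves_lines_def
proof
  fix l assume "l \<in> set lines"
  then obtain m where m: "m \<in> set lines" "q ` set l \<subseteq> set m"
    using assms(2) by (auto simp: preserves_lines_def)
  then obtain m' where m': "m' \<in> set lines" "p ` set m \<subseteq> set m'"
    using assms(1) by (auto simp: preserves_lines_def)
  have "(p \<circ> q) ` set l \<subseteq> set m'"
    using m(2) m'(2) by (auto simp: image_subset_iff)
  then show "\<exists>m\<in>set lines. (p \<circ> q) ` set l \<subseteq> set m"
    using m'(1) ..
qed

lemma apply_table_preserves_lines: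
  assumes "list_all (\<lambda>l. list_ex (\<lambda>m. list_all (List.member m) (permute_list_by l P)) lines) lines"
  shows "preserves_lines (apply_table P)"
  unfolding preserves_lines_def
proof
  fix l assume l: "l \<in> set lines"
  obtain m where m: "m \<in> set lines" "\<forall>i\<in>set l. P ! (i - 1) \<in> set m"
    using assms l by (auto simp: list_all_iff list_ex_iff permute_list_by_def)
  have "apply_table P ` set l \<subseteq> set m"
    using lines_subset_cells[OF l] m(2) by (auto simp: apply_table_def)
  then show "\<exists>m\<in>set lines. apply_table P ` set l \<subseteq> set m"
    using m(1) ..
qed

lemma rotate_preserves_lines: "preserves_lines rotate_cell"
proof (rule apply_table_preserves_lines)
  show "list_all (\<lambda>l. list_ex (\<lambda>m. list_all (List.member m) (permute_list_by l rotation_table)) lines) lines"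
    by code_simp
qed

lemma reflect_preserves_lines: "preserves_lines reflect_cell"
proof (rule apply_table_preserves_lines)
  show "list_all (\<lambda>l. list_ex (\<lambda>m. list_all (List.member m) (permute_list_by l reflection_table)) lines) lines"
    by code_simp
qed

lemma rotations_preserve_lines: "preserves_lines (rotate_cell ^^ k)"
proof (induction k)
  case 0
  show ?case by (auto simp: preserves_lines_def)
next
  case (Suc k)
  then show ?case
    using preserves_lines_comp[OF rotate_preserves_lines] by (simp only: funpow.simps)
qed

lemma geometric_preserves_lines: "p \<in> geometric_symmetries \<Longrightarrow> preserves_lines p"
  unfolding geometric_symmetries_eq
  using rotations_preserve_lines preserves_lines_comp[OF rotations_preserve_lines reflect_preserves_lines]
  by blast

text \<open>\<open>p\<close> is injective and carries the line into another one, where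
  \<open>t\<close> is injective.\<close>

lemma geometric_line_inj:
  assumes "p \<in> geometric_symmetries" "t \<in> valid_boards" "l \<in> set lines"
  shows "inj_on (t \<circ> p) (set l)"
proof -
  obtain m where "m \<in> set lines" "p ` set l \<subseteq> set m"
    using geometric_preserves_lines[OF assms(1)] assms(3) by (auto simp: preserves_lines_def)
  then have "inj_on t (p ` set l)"
    using assms(2) valid_boards_iff inj_on_subset by blast
  moreover have "inj_on p (set l)"
    using geometric_permutes[OF assms(1)] permutes_inj_on by blast
  ultimately show ?thesis
    by (rule comp_inj_on[rotated])
qed

subsection \<open>Similarity of boards\<close>

text \<open>Explicit form of lying in one orbit. Evaluating \<open>t\<close> at \<open>p i\<close>
  avoids inverses and agrees with \<open>move_cells\<close>.\<close>

definition similar :: "((nat \<Rightarrow> nat) \<times> (nat \<Rightarrow> nat)) set" where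
  "similar = {(s, t). s \<in> boards \<and> t \<in> boards \<and>
    (\<exists>p\<in>geometric_symmetries. \<exists>q. q permutes symbols \<and> (\<forall>i\<in>cells. t (p i) = q (s i)))}"

lemma similarI:
  assumes "s \<in> boards" "t \<in> boards" "p \<in> geometric_symmetries" "q permutes symbols"
    "\<And>i. i \<in> cells \<Longrightarrow> t (p i) = q (s i)"
  shows "(s, t) \<in> similar"
  using assms by (auto simp: similar_def)

lemma similarE:
  assumes "(s, t) \<in> similar"
  obtains p q where "s \<in> boards" "t \<in> boards" "p \<in> geometric_symmetries" "q permutes symbols"
    "\<And>i. i \<in> cells \<Longrightarrow> t (p i) = q (s i)"
  using assms by (auto simp: similar_def)

lemma similar_refl: "s \<in> boards \<Longrightarrow> (s, s) \<in> similar"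
  by (rule similarI[OF _ _ id_geometric permutes_id]) simp_all

lemma similar_sym:
  assumes "(s, t) \<in> similar"
  shows "(t, s) \<in> similar"
  using assms
proof (rule similarE)
  fix p q
  assume st: "s \<in> boards" "t \<in> boards" and p: "p \<in> geometric_symmetries"
    and q: "q permutes symbols" and eq: "\<And>i. i \<in> cells \<Longrightarrow> t (p i) = q (s i)"
  show ?thesis
  proof (rule similarI[OF st(2,1) geometric_inv[OF p] permutes_inv[OF q]])
    fix i assume "i \<in> cells"
    then have "Hilbert_Choice.inv p i \<in> cells"
      using geometric_permutes[OF p] permutes_inv permutes_in_image by metis
    from eq[OF this] show "s (Hilbert_Choice.inv p i) = Hilbert_Choice.inv q (t i)"
      using permutes_inverses[OF geometric_permutes[OF p]] permutes_inverses[OF q] by metis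
  qed
qed

lemma similar_trans:
  assumes "(s, t) \<in> similar" "(t, u) \<in> similar"
  shows "(s, u) \<in> similar"
proof -
  obtain p q where st: "s \<in> boards" "t \<in> boards" "p \<in> geometric_symmetries" "q permutes symbols"
    "\<And>i. i \<in> cells \<Longrightarrow> t (p i) = q (s i)"
    using assms(1) by (rule similarE) (rule that)
  obtain p' q' where tu: "t \<in> boards" "u \<in> boards" "p' \<in> geometric_symmetries" "q' permutes symbols"
    "\<And>i. i \<in> cells \<Longrightarrow> u (p' i) = q' (t i)"
    using assms(2) by (rule similarE) (rule that)
  show ?thesis
  proof (rule similarI[OF st(1) tu(2) geometric_comp[OF tu(3) st(3)] permutes_compose[OF st(4) tu(4)]])
    fix i assume "i \<in> cells"
    then show "u ((p' \<circ> p) i) = (q' \<circ> q) (s i)"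
      using st(5) tu(5) permutes_in_image[OF geometric_permutes[OF st(3)]] by simp
  qed
qed

text \<open>On a line, \<open>q\<close> after \<open>s\<close> agrees with \<open>t\<close> after
  \<open>p\<close>, which is injective; the inner map \<open>s\<close> is then injective as
  well.\<close>

lemma similar_valid:
  assumes "(s, t) \<in> similar" "t \<in> valid_boards"
  shows "s \<in> valid_boards"
  using assms(1)
proof (rule similarE)
  fix p q
  assume s: "s \<in> boards" and p: "p \<in> geometric_symmetries"
    and eq: "\<And>i. i \<in> cells \<Longrightarrow> t (p i) = q (s i)"
  have "inj_on s (set l)" if l: "l \<in> set lines" for l
  proof -
    have "(t \<circ> p) i = (q \<circ> s) i" if "i \<in> set l" for i
      using eq lines_subset_cells[OF l] that by auto
    then have "inj_on (q \<circ> s) (set l)"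
      using geometric_line_inj[OF p assms(2) l] inj_on_cong by metis
    then show ?thesis
      by (rule inj_on_imageI2)
  qed
  with s show ?thesis
    by (simp add: valid_boards_iff)
qed

subsection \<open>Orbits are similarity classes\<close>

lemma moved_board: "p permutes cells \<Longrightarrow> s \<in> boards \<Longrightarrow> move_cells p s \<in> boards"
proof -
  assume p: "p permutes cells" and s: "s \<in> boards"
  have "inv_into cells p i \<in> cells" if "i \<in> cells" for i
    using p that by (metis inv_into_into permutes_image)
  then show ?thesis
    using s by (auto simp: move_cells_def boards_def intro!: PiE_I)
qed

lemma move_cells_apply:
  assumes "p permutes cells" "s \<in> boards" "i \<in> cells"
  shows "move_cells p s (p i) = s i"
  using assms by (simp add: move_cells_def permutes_in_image permutes_inj_on)

lemma relabelled_board: "q permutes symbols \<Longrightarrow> s \<in> boards \<Longrightarrow> relabel q s \<in> boards"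
  by (auto simp: relabel_def boards_def permutes_in_image)

lemma relabel_apply: "s \<in> boards \<Longrightarrow> i \<in> cells \<Longrightarrow> relabel q s i = q (s i)"
  by (simp add: relabel_def)

lemma move_cells_Bij:
  assumes p: "p permutes cells"
  shows "move_cells p \<in> Bij boards"
proof -
  \<comment> \<open>Stated for an arbitrary pair, so that it covers \<open>p\<close> followed by its
    inverse and the inverse followed by \<open>p\<close>.\<close>
  have *: "move_cells p' (move_cells p s) = s"
    if "p permutes cells" "p' permutes cells" "\<And>i. p' (p i) = i" "s \<in> boards" for p p' s
  proof (rule board_eqI)
    show "move_cells p' (move_cells p s) \<in> boards"
      using that by (simp add: moved_board)
    fix i assume i: "i \<in> cells"
    then have "p i \<in> cells"
      using permutes_in_image[OF that(1)] by simp
    then have "move_cells p' (move_cells p s) (p' (p i)) = move_cells p s (p i)"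
      by (rule move_cells_apply[OF that(2) moved_board[OF that(1,4)]])
    then show "move_cells p' (move_cells p s) i = s i"
      using move_cells_apply[OF that(1,4) i] that(3) by simp
  qed fact
  let ?p' = "Hilbert_Choice.inv p"
  have "bij_betw (move_cells p) boards boards"
    using p permutes_inv[OF p]
    by (intro bij_betw_byWitness[of _ "move_cells ?p'"])
      (auto simp: * moved_board permutes_inverses)
  then show ?thesis
    by (simp add: Bij_def move_cells_def)
qed

lemma relabel_Bij:
  assumes q: "q permutes symbols"
  shows "relabel q \<in> Bij boards"
proof -
  have *: "relabel q' (relabel q s) = s"
    if "q permutes symbols" "q' permutes symbols" "\<And>v. q' (q v) = v" "s \<in> boards" for q q' s
    by (rule board_eqI) (use that in \<open>simp_all add: relabelled_board relabel_apply\<close>)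
  let ?q' = "Hilbert_Choice.inv q"
  have "bij_betw (relabel q) boards boards"
    using q permutes_inv[OF q]
    by (intro bij_betw_byWitness[of _ "relabel ?q'"])
      (auto simp: * relabelled_board permutes_inverses)
  then show ?thesis
    by (simp add: Bij_def relabel_def)
qed

lemma similar_move_cells:
  assumes "p \<in> geometric_symmetries" "s \<in> boards"
  shows "(s, move_cells p s) \<in> similar"
  using assms geometric_permutes[OF assms(1)]
  by (intro similarI[OF _ _ assms(1) permutes_id]) (auto simp: moved_board move_cells_apply)

lemma similar_relabel:
  assumes "q permutes symbols" "s \<in> boards"
  shows "(s, relabel q s) \<in> similar"
  using assms by (intro similarI[OF _ _ id_geometric assms(1)]) (auto simp: relabelled_board relabel_apply)

definition generators :: "((nat \<Rightarrow> nat) \<Rightarrow> (nat \<Rightarrow> nat)) set" where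
  "generators = move_cells ` geometric_symmetries \<union> relabel ` {q. q permutes symbols}"

lemma carrier_septoku_group: "carrier septoku_group = generate (BijGroup boards) generators"
  by (simp add: septoku_group_def generators_def)

lemma generators_Bij: "generators \<subseteq> Bij boards"
  by (auto simp: generators_def intro: move_cells_Bij relabel_Bij geometric_permutes)

lemma generators_similar: "h \<in> generators \<Longrightarrow> s \<in> boards \<Longrightarrow> (s, h s) \<in> similar"
  by (auto simp: generators_def intro: similar_move_cells similar_relabel)

text \<open>Each generator sends a board to a similar one. Reflexivity, symmetry and transitivity
  handle the unit, inverses and products.\<close>

lemma septoku_group_similar:
  assumes "g \<in> carrier septoku_group" "s \<in> boards"
  shows "(s, g s) \<in> similar"
  using assms unfolding carrier_septoku_group
proof (induction arbitrary: s rule: generate.induct)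
  case one
  then show ?case by (simp add: BijGroup_def similar_refl)
next
  case (incl h)
  then show ?case by (simp add: generators_similar)
next
  case (inv h)
  have h: "h \<in> Bij boards"
    using inv generators_Bij by blast
  then have bij: "bij_betw h boards boards"
    by (simp add: Bij_def)
  have "(inv\<^bsub>BijGroup boards\<^esub> h) s = inv_into boards h s"
    using inv h by (simp add: inv_BijGroup)
  moreover have "inv_into boards h s \<in> boards" "h (inv_into boards h s) = s"
    using bij inv by (auto simp: bij_betw_def inv_into_into f_inv_into_f)
  ultimately show ?case
    using generators_similar[OF inv(1)] similar_sym by metis
next
  case (eng h1 h2)
  interpret group "BijGroup boards" by (rule group_BijGroup)
  have *: "generate (BijGroup boards) generators \<subseteq> carrier (BijGroup boards)"
    using generators_Bij by (intro generate_incl) (simp add: BijGroup_def)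
  have "h1 \<in> Bij boards" "h2 \<in> Bij boards"
    using eng * by (auto simp: BijGroup_def)
  then have "(h1 \<otimes>\<^bsub>BijGroup boards\<^esub> h2) s = h1 (h2 s)"
    using eng.prems by (simp add: BijGroup_def compose_def)
  moreover have "(s, h2 s) \<in> similar"
    using eng by blast
  \<comment> \<open>Similarity of \<open>s\<close> and \<open>h2 s\<close> includes that
    \<open>h2 s\<close> is a board, so the hypothesis on \<open>h1\<close> applies to it.\<close>
  moreover have "(h2 s, h1 (h2 s)) \<in> similar"
    using \<open>(s, h2 s) \<in> similar\<close> eng.IH(1) by (auto simp: similar_def)
  ultimately show ?case
    using similar_trans by metis
qed

text \<open>The converse: a single product of one cell move and one relabelling already reaches
  \<open>t\<close>.\<close>

lemma similar_septoku_group: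
  assumes "(s, t) \<in> similar"
  obtains g where "g \<in> carrier septoku_group" "t = g s"
  using assms
proof (rule similarE)
  fix p q
  assume st: "s \<in> boards" "t \<in> boards" and p: "p \<in> geometric_symmetries"
    and q: "q permutes symbols" and eq: "\<And>i. i \<in> cells \<Longrightarrow> t (p i) = q (s i)"
  let ?g = "relabel q \<otimes>\<^bsub>BijGroup boards\<^esub> move_cells p"
  have p': "p permutes cells"
    by (rule geometric_permutes[OF p])
  have "relabel q \<in> generators" "move_cells p \<in> generators"
    using p q by (auto simp: generators_def)
  then have "?g \<in> carrier septoku_group"
    unfolding carrier_septoku_group by (intro generate.eng generate.incl)
  moreover have "t = ?g s"
  proof -
    have "?g s = relabel q (move_cells p s)"
      using move_cells_Bij[OF p'] relabel_Bij[OF q] st by (simp add: BijGroup_def compose_def)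
    moreover have "t = relabel q (move_cells p s)"
    proof (rule board_eqI[OF st(2)])
      show "relabel q (move_cells p s) \<in> boards"
        by (rule relabelled_board[OF q moved_board[OF p' st(1)]])
      fix i assume "i \<in> cells"
      then obtain j where j: "i = p j" "j \<in> cells"
        using permutes_image[OF p'] by blast
      have "relabel q (move_cells p s) (p j) = q (move_cells p s (p j))"
        using relabel_apply[OF moved_board[OF p' st(1)]] \<open>i \<in> cells\<close> j(1) by simp
      then show "t i = relabel q (move_cells p s) i"
        using move_cells_apply[OF p' st(1) j(2)] eq[OF j(2)] j(1) by simp
    qed
    ultimately show ?thesis
      by simp
  qed
  ultimately show thesis by (rule that)
qed

lemma orbit_eq_similar:
  assumes "s \<in> boards"
  shows "orbit septoku_group (\<lambda>g. g) s = similar `` {s}"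
proof
  show "orbit septoku_group (\<lambda>g. g) s \<subseteq> similar `` {s}"
    using septoku_group_similar[OF _ assms] by (auto simp: orbit_def)
  show "similar `` {s} \<subseteq> orbit septoku_group (\<lambda>g. g) s"
  proof
    fix t assume "t \<in> similar `` {s}"
    then obtain g where "g \<in> carrier septoku_group" "t = g s"
      using similar_septoku_group by blast
    then show "t \<in> orbit septoku_group (\<lambda>g. g) s"
      by (auto simp: orbit_def)
  qed
qed

text \<open>A board similar to a valid one is valid, so restricting the relation to valid boards
  does not shrink their orbits.\<close>

lemma septoku_orbits_eq: "septoku_orbits = valid_boards // (similar \<inter> valid_boards \<times> valid_boards)"
proof -
  have "orbit septoku_group (\<lambda>g. g) s = (similar \<inter> valid_boards \<times> valid_boards) `` {s}"
    if "s \<in> valid_boards" for s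
    using that similar_valid[OF similar_sym] by (auto simp: orbit_eq_similar valid_boards_iff)
  then show ?thesis
    by (auto simp: septoku_orbits_def orbits_def quotient_def)
qed

lemma equiv_similar_valid: "equiv valid_boards (similar \<inter> valid_boards \<times> valid_boards)"
proof (rule equivI)
  show "similar \<inter> valid_boards \<times> valid_boards \<subseteq> valid_boards \<times> valid_boards"
    by blast
  show "refl_on valid_boards (similar \<inter> valid_boards \<times> valid_boards)"
    by (auto simp: refl_on_def valid_boards_iff intro: similar_refl)
  show "sym (similar \<inter> valid_boards \<times> valid_boards)"
    by (rule symI) (blast intro: similar_sym)
  show "trans (similar \<inter> valid_boards \<times> valid_boards)"
    by (rule transI) (blast intro: similar_trans)
qed

subsection \<open>The six representatives\<close>

definition board_of :: "nat list \<Rightarrow> nat \<Rightarrow> nat" where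
  "board_of xs = (\<lambda>i\<in>cells. xs ! (i - 1))"

lemma list_eq_board: "length xs = 37 \<Longrightarrow> map (board_of xs) cell_list = xs"
  by (rule nth_equalityI) (auto simp: board_of_def cells_def nth_cell_list)

lemma permute_list_by_apply_table:
  assumes "set P = cells" "length P = 37"
  shows "permute_list_by P (map t cell_list) = map (t \<circ> apply_table P) cell_list"
proof (rule nth_equalityI)
  show "length (permute_list_by P (map t cell_list)) = length (map (t \<circ> apply_table P) cell_list)"
    by (simp add: permute_list_by_def assms)
  fix n assume "n < length (permute_list_by P (map t cell_list))"
  then have n: "n < 37"
    by (simp add: permute_list_by_def assms)
  then have "P ! n \<in> cells"
    using assms nth_mem[of n P] by simp
  then have "permute_list_by P (map t cell_list) ! n = t (P ! n)"
    using n assms(2) nth_map_cell_list[of "P ! n" t] by (simp add: permute_list_by_def)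
  with n show "permute_list_by P (map t cell_list) ! n = map (t \<circ> apply_table P) cell_list ! n"
    by (simp add: apply_table_def cells_def nth_cell_list)
qed

text \<open>Each recursive call replaces \<open>t\<close> by \<open>t\<close> after
  \<open>rotate_cell\<close>, hence the induction for arbitrary \<open>t\<close>.\<close>

lemma set_rotations:
  "set (rotations n (map t cell_list)) = (\<lambda>k. map (t \<circ> rotate_cell ^^ k) cell_list) ` {..<n}"
proof (induction n arbitrary: t)
  case 0
  then show ?case by simp
next
  case (Suc n)
  have "permute_list_by rotation_table (map t cell_list) = map (t \<circ> rotate_cell) cell_list"
    using sort_eq_cells[OF sort_rotation_table] by (intro permute_list_by_apply_table)
  then show ?case
    by (simp add: Suc lessThan_Suc_eq_insert_0 image_image comp_assoc funpow_Suc_right[symmetric]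
        del: funpow.simps(2) o_apply flip: funpow_Suc_right) (simp del: o_apply)
qed

text \<open>The computed lists are exactly the compositions of \<open>t\<close> with a symmetry, the
  form in which \<open>similar\<close> reads \<open>t\<close>.\<close>

lemma set_images:
  "set (images (map t cell_list)) = (\<lambda>p. map (t \<circ> p) cell_list) ` geometric_symmetries"
proof -
  have "permute_list_by reflection_table (map u cell_list) = map (u \<circ> reflect_cell) cell_list" for u
    using sort_eq_cells[OF sort_reflection_table] by (intro permute_list_by_apply_table)
  then show ?thesis
    unfolding images_def geometric_symmetries_eq
    by (simp add: set_rotations image_Un image_image comp_assoc)
qed

lemma set_middle_row: "set middle_row = (\<lambda>v. v + 15) ` symbols"
  by (simp add: middle_row_def symbols_list)  blast

text \<open>The seven cells 16 to 22, read through \<open>p\<close>, carry distinct symbols; an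
  injective map of the seven symbols to themselves is bijective.\<close>

lemma geometric_middle_row:
  assumes "p \<in> geometric_symmetries" "t \<in> valid_boards"
  shows "bij_betw (\<lambda>v. t (p (v + 15))) symbols symbols"
proof -
  have *: "v + 15 \<in> cells" if "v \<in> symbols" for v
    using that by (auto simp: cells_def symbols_def)
  have "rev middle_row \<in> set lines"
    by (simp add: middle_row_def lines_def)
  from geometric_line_inj[OF assms this] have "inj_on (t \<circ> p) ((\<lambda>v. v + 15) ` symbols)"
    by (simp add: set_middle_row)
  then have "inj_on ((t \<circ> p) \<circ> (\<lambda>v. v + 15)) symbols"
    by (intro comp_inj_on) (auto simp: inj_on_def)
  then have inj: "inj_on (\<lambda>v. t (p (v + 15))) symbols"
    by (simp add: comp_def)
  moreover have "(\<lambda>v. t (p (v + 15))) ` symbols \<subseteq> symbols"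
  proof (rule image_subsetI)
    fix v assume "v \<in> symbols"
    then have "p (v + 15) \<in> cells"
      using * permutes_in_image[OF geometric_permutes[OF assms(1)]] by simp
    then show "t (p (v + 15)) \<in> symbols"
      using assms(2) by (intro board_symbol) (simp_all add: valid_boards_iff)
  qed
  ultimately show ?thesis
    by (simp add: bij_betw_def endo_inj_surj symbols_def)
qed

lemma permutes_of_bij_betw:
  assumes "bij_betw f A A"
  shows "(\<lambda>x. if x \<in> A then f x else x) permutes A"
  by (rule bij_imp_permutes) (use assms in \<open>auto cong: bij_betw_cong\<close>)

definition normalized :: "(nat \<Rightarrow> nat) \<Rightarrow> bool" where
  "normalized s \<longleftrightarrow> (\<forall>v\<in>symbols. s (v + 15) = v)"

lemma matches_map:
  assumes "r \<in> boards"
  shows "matches (map r cell_list) (map t cell_list) \<longleftrightarrow> (\<forall>i\<in>cells. t i = t (r i + 15))"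
proof -
  \<comment> \<open>Position \<open>v + 14\<close> of the list belongs to cell
    \<open>v + 15\<close>.\<close>
  have "map t cell_list ! (r i + 14) = t (r i + 15)" if "i \<in> cells" for i
  proof -
    have "r i \<in> symbols"
      by (rule board_symbol) fact+
    then show ?thesis
      using nth_map_cell_list[of "r i + 15" t] by (auto simp: symbols_def cells_def add.commute)
  qed
  then show ?thesis
    unfolding matches_def map_map by auto
qed

text \<open>As \<open>r\<close> reads 1 to 7 in the middle row, the relabelling must send
  \<open>v\<close> to \<open>t (p (v + 15))\<close>. Substituting this leaves a condition on
  \<open>p\<close> alone; conversely, \<open>geometric_middle_row\<close> makes this map a
  permutation.\<close>

lemma similar_iff_matches:
  assumes r: "r \<in> boards" "normalized r" and t: "t \<in> valid_boards"
  shows "(r, t) \<in> similar \<longleftrightarrow>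
    list_ex (matches (map r cell_list)) (images (map t cell_list))"
proof -
  have "(r, t) \<in> similar \<longleftrightarrow>
    (\<exists>p\<in>geometric_symmetries. \<forall>i\<in>cells. t (p i) = t (p (r i + 15)))"
  proof
    assume "(r, t) \<in> similar"
    then obtain p q where "r \<in> boards" "t \<in> boards" and pq: "p \<in> geometric_symmetries"
      and "q permutes symbols" and eq: "\<And>i. i \<in> cells \<Longrightarrow> t (p i) = q (r i)"
      by (rule similarE) (rule that)
    have "t (p i) = t (p (r i + 15))" if "i \<in> cells" for i
    proof -
      have "r i \<in> symbols"
        by (rule board_symbol) fact+
      then have "r i + 15 \<in> cells" "r (r i + 15) = r i"
        using r(2) by (auto simp: symbols_def cells_def normalized_def)
      with eq that show ?thesis by metis
    qed
    with pq show "\<exists>p\<in>geometric_symmetries. \<forall>i\<in>cells. t (p i) = t (p (r i + 15))"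
      by blast
  next
    assume "\<exists>p\<in>geometric_symmetries. \<forall>i\<in>cells. t (p i) = t (p (r i + 15))"
    then obtain p where p: "p \<in> geometric_symmetries" "\<forall>i\<in>cells. t (p i) = t (p (r i + 15))"
      by blast
    show "(r, t) \<in> similar"
      using p t r board_symbol[OF r(1)]
      by (intro similarI[OF _ _ p(1) permutes_of_bij_betw[OF geometric_middle_row[OF p(1) t]]])
        (auto simp: valid_boards_iff)
  qed
  also have "\<dots> \<longleftrightarrow> list_ex (matches (map r cell_list)) (images (map t cell_list))"
    by (simp add: list_ex_iff set_images matches_map r)
  finally show ?thesis .
qed

lemma normalize:
  assumes "s \<in> valid_boards"
  obtains s' where "s' \<in> valid_boards" "normalized s'" "(s, s') \<in> similar"
proof -
  \<comment> \<open>The middle row of \<open>s\<close> as a permutation; its inverse normalizes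
    \<open>s\<close>. The \<open>id\<close> fits the instance of \<open>geometric_middle_row\<close>
    for the identity symmetry.\<close>
  define q where "q = (\<lambda>v. if v \<in> symbols then s (id (v + 15)) else v)"
  have q: "q permutes symbols"
    unfolding q_def by (rule permutes_of_bij_betw[OF geometric_middle_row[OF id_geometric assms]])
  have s: "s \<in> boards"
    using assms by (simp add: valid_boards_iff)
  let ?s' = "relabel (Hilbert_Choice.inv q) s"
  have sim: "(s, ?s') \<in> similar"
    using permutes_inv[OF q] s by (rule similar_relabel)
  have "?s' (v + 15) = v" if "v \<in> symbols" for v
  proof -
    have "v + 15 \<in> cells"
      using that by (auto simp: cells_def symbols_def)
    then have "?s' (v + 15) = Hilbert_Choice.inv q (q v)"
      using s that by (simp add: relabel_apply q_def)
    then show ?thesis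
      using permutes_inverses(2)[OF q] by simp
  qed
  then have "normalized ?s'"
    by (simp add: normalized_def)
  moreover have "?s' \<in> valid_boards"
    using similar_valid[OF similar_sym[OF sim] assms] .
  ultimately show thesis
    using sim that by blast
qed

lemma normalized_found:
  assumes "s \<in> valid_boards" "normalized s"
  shows "map s cell_list \<in> set (map (by_cell (rev filling_order @ middle_row))
      (search filling_order middle_row [[7,6,5,4,3,2,1]]))"
proof -
  note ord = sort_eq_cells[OF sort_filling_order]
  have "map s middle_row = map s (map (\<lambda>v. v + 15) [7,6,5,4,3,2,1])"
    by (simp add: middle_row_def)
  also have "\<dots> = [7,6,5,4,3,2,1]"
    using assms(2) unfolding normalized_def symbols_list by simp
  finally have "map s middle_row \<in> set [[7,6,5,4,3,2,1]]"
    by simp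
  moreover have "set filling_order \<subseteq> cells" "distinct (filling_order @ middle_row)"
    using ord by auto
  ultimately have "map s (rev filling_order @ middle_row) \<in>
      set (search filling_order middle_row [[7,6,5,4,3,2,1]])"
    using assms(1) by (intro search_complete)
  moreover have "by_cell (rev filling_order @ middle_row) (map s (rev filling_order @ middle_row)) =
      map s cell_list"
    by (rule by_cell_map[OF ord(1)])
  ultimately show ?thesis
    by (metis image_eqI set_map)
qed

lemma representatives_lists:
  "list_all (\<lambda>r. length r = 37 \<and> list_all (\<lambda>v. List.member [1,2,3,4,5,6,7] v) r \<and>
     list_all (\<lambda>v. r ! (v + 14) = v) [1,2,3,4,5,6,7]) representatives"
  by code_simp

lemma representative_board:
  assumes "r \<in> set representatives"
  shows "map (board_of r) cell_list = r" "board_of r \<in> boards" "normalized (board_of r)"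
    "board_of r \<in> valid_boards"
proof -
  have len: "length r = 37" and sym: "set r \<subseteq> symbols" 
    and norm: "\<forall>v\<in>symbols. r ! (v + 14) = v"
    using representatives_lists assms by (auto simp: list_all_iff symbols_list)
  show "map (board_of r) cell_list = r"
    using len by (rule list_eq_board)
  have "r ! (i - 1) \<in> symbols" if "i \<in> cells" for i
    using len sym that nth_mem[of "i - 1" r] by (auto simp: cells_def)
  then show board: "board_of r \<in> boards"
    by (auto simp: board_of_def boards_def)
  show "normalized (board_of r)"
    using norm by (auto simp: normalized_def board_of_def symbols_def cells_def add.commute)
  have "inj_on (board_of r) (set l)" if "l \<in> set lines" for l
  proof -
    have "distinct (permute_list_by l r)"
      using representatives_valid assms that by (auto simp: list_all_iff)
    moreover have "permute_list_by l r = map (board_of r) l"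
      using lines_subset_cells[OF that] by (auto simp: permute_list_by_def board_of_def)
    ultimately show ?thesis
      by (simp add: distinct_map)
  qed
  with board show "board_of r \<in> valid_boards"
    by (simp add: valid_boards_iff)
qed

text \<open>The map from an index below 6 to the class of its representative is onto by completeness
  of the search and injective by inequivalence.\<close>

lemma card_septoku_orbits: "card septoku_orbits = 6"
proof -
  let ?R = "similar \<inter> valid_boards \<times> valid_boards"
  let ?b = "\<lambda>i. board_of (representatives ! i)"
  let ?C = "\<lambda>i. ?R `` {?b i}"
  have len: "length representatives = 6"
    by (simp add: representatives_def)
  have b: "?b i \<in> valid_boards" "?b i \<in> boards" "normalized (?b i)"
    "map (?b i) cell_list = representatives ! i" if "i < 6" for i
    using representative_board[of "representatives ! i"] that len by (simp_all)
  have eq: "septoku_orbits = ?C ` {..<6}"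
  proof
    show "?C ` {..<6} \<subseteq> septoku_orbits"
      unfolding septoku_orbits_eq using b(1) by (auto intro: quotientI)
    show "septoku_orbits \<subseteq> ?C ` {..<6}"
    proof
      fix X assume "X \<in> septoku_orbits"
      then obtain s where s: "s \<in> valid_boards" "X = ?R `` {s}"
        unfolding septoku_orbits_eq by (rule quotientE)
      obtain s' where s': "s' \<in> valid_boards" "normalized s'" "(s, s') \<in> similar"
        using normalize[OF s(1)] .
      \<comment> \<open>Only the outer quantifier over \<open>representatives\<close> is opened; the
        inner test keeps the form used in \<open>similar_iff_matches\<close>.\<close>
      obtain r where "r \<in> set representatives"
        "list_ex (matches r) (images (map s' cell_list))"
        using representatives_complete normalized_found[OF s'(1,2)]
        unfolding list_all_iff list_ex_iff[of _ representatives] by blast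
      then obtain i where i: "i < 6" 
        "list_ex (matches (representatives ! i)) (images (map s' cell_list))"
        using len by (auto simp: in_set_conv_nth)
      then have "(?b i, s') \<in> similar"
        using similar_iff_matches[OF b(2,3) s'(1)] b(4) by simp
      then have "(?b i, s) \<in> ?R"
        using s s' b(1)[OF i(1)] similar_sym similar_trans by blast
      then have "X = ?C i"
        unfolding s(2) using equiv_class_eq[OF equiv_similar_valid] by metis
      then show "X \<in> ?C ` {..<6}"
        using i(1) by blast
    qed
  qed
  have inj: "inj_on ?C {..<6}"
  proof (rule inj_onI)
    fix i j :: nat
    assume ij: "i \<in> {..<6}" "j \<in> {..<6}" "?C i = ?C j"
    then have "(?b i, ?b j) \<in> similar"
      using eq_equiv_class[OF _ equiv_similar_valid] b(1) by blast
    then have "list_ex (matches (representatives ! i)) (images (representatives ! j))"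
      using ij similar_iff_matches[OF b(2,3) b(1), of i j] b(4) by simp
    then show "i = j"
      using representatives_inequivalent ij(1,2) unfolding list_all_iff set_upt
      by (metis atLeastLessThan_iff le0 lessThan_iff)
  qed
  show ?thesis
    unfolding eq card_image[OF inj] by simp
qed

section \<open>Invariance of validity, the partition into orbits and their number\<close>

theorem theorem4:
  shows "(\<forall>g \<in> carrier septoku_group. \<forall>s \<in> valid_boards. g s \<in> valid_boards)
    \<and> partition_on valid_boards septoku_orbits
    \<and> card septoku_orbits = 6"
proof (intro conjI ballI)
  show "g s \<in> valid_boards" if "g \<in> carrier septoku_group" "s \<in> valid_boards" for g s
  proof -
    have "s \<in> boards"
      using that(2) by (simp add: valid_boards_iff)
    \<comment> \<open>\<open>similar_valid\<close> carries validity from the second board to the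
      first, hence the reversal.\<close>
    from similar_sym[OF septoku_group_similar[OF that(1) this]] that(2) show ?thesis
      by (rule similar_valid)
  qed
  show "partition_on valid_boards septoku_orbits"
    unfolding septoku_orbits_eq by (rule partition_on_quotient[OF equiv_similar_valid])
qed (rule card_septoku_orbits)

end
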